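(* Let $\mathcal{C}$ be an $[n,k,d]_q$ MDS code with $d\ge 4$. Let $\mathcal{V}_a^{(d-2)}$ and $\mathcal{V}_b^{(d-2)}$ be two of its weight $d-2$ cosets with different weight distributions. Then, independently of the values of $B_{d-2}(\mathcal{V}_a^{(d-2)})$ and $B_{d-2}(\mathcal{V}_b^{(d-2)})$, $$(-1)^{n+d}B_w(\mathcal{V}_a^{(d-2)})-B_{n+d-2-w}(\mathcal{V}_a^{(d-2)})=(-1)^{n+d}B_w(\mathcal{V}_b^{(d-2)})-B_{n+d-2-w}(\mathcal{V}_b^{(d-2)})$$ for all $w=d-1,d,\ldots,n$.
   Context: An $[n,k,d]_q$ code is a $k$-dimensional $\mathbb{F}_q$-linear subspace of $\mathbb{F}_q^n$ with minimum Hamming distance $d$; it is MDS if $d=n-k+1$. A coset of $\mathcal{C}$ is a translate $\mathcal{C}+\mathbf{v}$, $\mathbf{v}\in\mathbb{F}_q^n$; the weight of a coset is the smallest Hamming weight of a vector in it. $B_w(\mathcal{V})$ is the number of vectors of Hamming weight $w$ in the coset $\mathcal{V}$; the weight distribution of $\mathcal{V}$ is the sequence $(B_w(\mathcal{V}))_{0\le w\le n}$. *)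

theory Defs
  imports "HOL-Analysis.Cartesian_Space"
begin

text \<open>
  The field with \<open>q\<close> elements is a finite type \<open>'a\<close> of class \<open>field\<close> (so \<open>q = CARD('a)\<close>), and the
  ambient space is \<open>'a ^ 'n\<close> with \<open>n = CARD('n)\<close>.
\<close>

definition hamming_weight :: "('a::zero) ^ 'n \<Rightarrow> nat" where
  "hamming_weight x = card {i. x $ i \<noteq> 0}"

definition hamming_dist :: "'a ^ 'n \<Rightarrow> 'a ^ 'n \<Rightarrow> nat" where
  "hamming_dist x y = card {i. x $ i \<noteq> y $ i}"

text \<open>
  A code with fewer than two words has no minimum distance. The infimum of the empty set of
  natural numbers is \<open>0\<close>, so such codes are assigned the value \<open>0\<close>, which no other code attains.
\<close>

definition min_distance :: "('a ^ 'n) set \<Rightarrow> nat" where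
  "min_distance C = Inf {hamming_dist x y | x y. x \<in> C \<and> y \<in> C \<and> x \<noteq> y}"

definition linear_code :: "nat \<Rightarrow> nat \<Rightarrow> nat \<Rightarrow> ('a::{field,finite} ^ 'n) set \<Rightarrow> bool" where
  "linear_code n k d C \<longleftrightarrow>
     n = CARD('n) \<and> vec.subspace C \<and> vec.dim C = k \<and> min_distance C = d"

text \<open>The subtraction below never truncates, since \<open>k \<le> n\<close> for a linear code.\<close>

definition MDS_code :: "nat \<Rightarrow> nat \<Rightarrow> nat \<Rightarrow> ('a::{field,finite} ^ 'n) set \<Rightarrow> bool" where
  "MDS_code n k d C \<longleftrightarrow> linear_code n k d C \<and> d = n - k + 1"

definition is_coset :: "('a::plus ^ 'n) set \<Rightarrow> ('a ^ 'n) set \<Rightarrow> bool" where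
  "is_coset C V \<longleftrightarrow> (\<exists>v. V = (\<lambda>c. c + v) ` C)"

definition coset_weight :: "('a::zero ^ 'n) set \<Rightarrow> nat" where
  "coset_weight V = Inf (hamming_weight ` V)"

definition B :: "nat \<Rightarrow> ('a::zero ^ 'n) set \<Rightarrow> nat" where
  "B w V = card {x \<in> V. hamming_weight x = w}"

definition weight_distribution :: "('a::zero ^ 'n) set \<Rightarrow> nat list" where
  "weight_distribution V = map (\<lambda>w. B w V) [0..<CARD('n) + 1]"

end

theory Submission
  imports Defs
begin

text \<open>
  For a coset \<open>V\<close> and a set \<open>T\<close> of coordinates, count the vectors of \<open>V\<close> vanishing on \<open>T\<close>. An MDS
  code projects onto any \<open>k\<close> coordinates bijectively, so for \<open>card T \<le> k\<close> this number is the same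
  for all cosets of the code. Summing over all \<open>T\<close> of size \<open>t\<close> shows that
  \<open>\<Sum>u. B (n - u) V * (u choose t)\<close> does not depend on \<open>V\<close> for \<open>t \<le> k\<close>. The cosets considered have no
  vectors with more than \<open>k + 1\<close> zeros, so the differences \<open>e u = B (n - u) Va - B (n - u) Vb\<close> are the
  coefficients of a polynomial of degree at most \<open>k + 1\<close> whose Taylor expansion at \<open>1\<close> has only its
  top term. Hence it is a multiple of \<open>(x - 1) ^ (k + 1)\<close>, and the symmetry of the binomial
  coefficients is the claim.
\<close>

text \<open>The binomial moments are the Taylor coefficients at \<open>1\<close> of the polynomial
  with coefficients \<open>e u\<close>. Only the one of degree \<open>m\<close> survives, so the
  polynomial is \<open>e m * (y - 1) ^ m\<close>, and the coefficients can be read off. Over the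
  reals, this comparison follows from equality of polynomial functions.\<close>

lemma polynomial_coeffs_of_binomial_moments:
  fixes e :: "nat \<Rightarrow> real"
  assumes moments: "\<And>t. t < m \<Longrightarrow> (\<Sum>u\<le>m. e u * real (u choose t)) = 0"
    and "u \<le> m"
  shows "e u = e m * (real (m choose u) * (- 1) ^ (m - u))"
proof -
  have top: "(\<Sum>u\<le>m. e u * real (u choose m)) = e m"
  proof -
    have "(\<Sum>u\<le>m. e u * real (u choose m)) = (\<Sum>u\<le>m. if u = m then e m else 0)"
      by (intro sum.cong) auto
    then show ?thesis by simp
  qed
  \<comment> \<open>Expanding around \<open>1\<close> turns the \<open>t\<close>-th moment into the
    coefficient of \<open>x ^ t\<close>.\<close>
  have shifted: "(\<Sum>u\<le>m. e u * (x + 1) ^ u) = e m * x ^ m" for x :: real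
  proof -
    have "(\<Sum>u\<le>m. e u * (x + 1) ^ u) = (\<Sum>u\<le>m. \<Sum>t\<le>m. e u * (real (u choose t) * x ^ t))"
    proof (rule sum.cong)
      fix u assume "u \<in> {..m}"
      then have "(\<Sum>t\<le>u. real (u choose t) * x ^ t) = (\<Sum>t\<le>m. real (u choose t) * x ^ t)"
        by (intro sum.mono_neutral_left) auto
      then show "e u * (x + 1) ^ u = (\<Sum>t\<le>m. e u * (real (u choose t) * x ^ t))"
        by (simp add: binomial_ring sum_distrib_left)
    qed simp
    also have "\<dots> = (\<Sum>t\<le>m. (\<Sum>u\<le>m. e u * real (u choose t)) * x ^ t)"
      by (subst sum.swap) (simp add: sum_distrib_right mult.assoc)
    also have "\<dots> = (\<Sum>t\<le>m. if t = m then e m * x ^ m else 0)"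
      by (intro sum.cong) (auto simp: moments top)
    finally show ?thesis by simp
  qed
  have "\<forall>y. (\<Sum>u\<le>m. e u * y ^ u)
      = (\<Sum>u\<le>m. (e m * (real (m choose u) * (- 1) ^ (m - u))) * y ^ u)"
  proof
    fix y :: real
    have "(\<Sum>u\<le>m. e u * y ^ u) = e m * (y + - 1) ^ m"
      using shifted[of "y - 1"] by simp
    also have "\<dots> = (\<Sum>u\<le>m. (e m * (real (m choose u) * (- 1) ^ (m - u))) * y ^ u)"
      by (subst binomial_ring) (simp add: sum_distrib_left mult_ac)
    finally show "(\<Sum>u\<le>m. e u * y ^ u)
      = (\<Sum>u\<le>m. (e m * (real (m choose u) * (- 1) ^ (m - u))) * y ^ u)" .
  qed
  then show ?thesis
    unfolding polyfun_eq_coeffs using \<open>u \<le> m\<close> by blast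
qed

lemma binomial_moments_symmetry:
  fixes e :: "nat \<Rightarrow> int"
  assumes "\<And>t. t < m \<Longrightarrow> (\<Sum>u\<le>m. e u * int (u choose t)) = 0"
    and "u \<le> m"
  shows "e (m - u) = (- 1) ^ m * e u"
proof -
  have moments: "(\<Sum>u\<le>m. real_of_int (e u) * real (u choose t)) = 0" if "t < m" for t
    using arg_cong[OF assms(1)[OF that], of real_of_int] by simp
  have "real_of_int (e (m - u)) = e m * (real (m choose (m - u)) * (- 1) ^ (m - (m - u)))"
    by (rule polynomial_coeffs_of_binomial_moments[OF moments]) auto
  \<comment> \<open>The exponents \<open>u\<close> and \<open>m + (m - u)\<close> have the same
    parity.\<close>
  also have "\<dots> = (- 1) ^ m * (e m * (real (m choose u) * (- 1) ^ (m - u)))"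
    using \<open>u \<le> m\<close>
    by (auto simp: minus_one_power_iff binomial_symmetric[symmetric])
  also have "\<dots> = (- 1) ^ m * real_of_int (e u)"
    using polynomial_coeffs_of_binomial_moments[OF moments \<open>u \<le> m\<close>] by simp
  finally have "real_of_int (e (m - u)) = real_of_int ((- 1) ^ m * e u)"
    by simp
  then show ?thesis by (simp only: of_int_eq_iff)
qed

text \<open>Distinct codewords that agree on \<open>k\<close> coordinates would differ in at most
  \<open>n - k < d\<close> places. Hence restriction to \<open>k\<close> coordinates is injective on
  \<open>C\<close>, and by equality of dimensions it is onto.\<close>

lemma MDS_code_interpolation:
  fixes C :: "('a::{field,finite} ^ 'n) set"
  assumes mds: "MDS_code n k d C" and "card T \<le> k"
  obtains c where "c \<in> C" "\<And>i. i \<in> T \<Longrightarrow> c $ i = y $ i"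
proof -
  have n: "n = CARD('n)" and sub: "vec.subspace C" and dim: "vec.dim C = k"
    and dist: "min_distance C = d" and d: "d = n - k + 1"
    using mds by (auto simp: MDS_code_def linear_code_def)
  have "k \<le> CARD('n)"
    using vec.dim_subset[of C UNIV] dim by (simp add: vec.dim_UNIV vec.dimension_def card_cart_basis)
  \<comment> \<open>Exactly \<open>k\<close> coordinates are needed for the dimensions to
    match.\<close>
  then obtain T' where T': "T \<subseteq> T'" "card T' = k"
    using exists_subset_between[of T k UNIV] \<open>card T \<le> k\<close> by auto
  define P :: "'a ^ 'n \<Rightarrow> 'a ^ 'n" where "P x = (\<chi> i. if i \<in> T' then x $ i else 0)" for x
  have lin: "Vector_Spaces.linear (*s) (*s) P"
    by unfold_locales (auto simp: P_def vec_eq_iff algebra_simps)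
  have "inj_on P C"
  proof (rule inj_onI, rule ccontr)
    fix x y assume xy: "x \<in> C" "y \<in> C" "P x = P y" "x \<noteq> y"
    then have "d \<le> hamming_dist x y"
      unfolding dist[symmetric] min_distance_def by (intro cInf_lower) auto
    moreover have "x $ i = y $ i" if "i \<in> T'" for i
      using xy(3) that by (auto simp: P_def vec_eq_iff) metis
    then have "{i. x $ i \<noteq> y $ i} \<subseteq> - T'" by auto
    then have "hamming_dist x y \<le> card (- T')"
      unfolding hamming_dist_def by (intro card_mono) auto
    moreover have "card (- T') = n - k"
      using T' n by (simp add: Compl_eq_Diff_UNIV card_Diff_subset)
    ultimately show False using d by simp
  qed
  then have "vec.dim (P ` C) = k"
    using vec.dim_image_eq[OF lin, of C] dim sub by (metis vec.span_eq_iff)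
  moreover have "vec.subspace (P ` C)"
    using vec.linear_subspace_image[OF lin sub] .
  moreover have "vec.subspace {x :: 'a ^ 'n. \<forall>i. i \<notin> T' \<longrightarrow> x $ i = 0}"
    by (auto simp: vec.subspace_def)
  moreover have "P ` C \<subseteq> {x. \<forall>i. i \<notin> T' \<longrightarrow> x $ i = 0}"
    by (auto simp: P_def)
  ultimately have "P ` C = {x. \<forall>i. i \<notin> T' \<longrightarrow> x $ i = 0}"
    using T' by (intro vec.subspace_dim_equal) (auto simp: dim_substandard_cart)
  moreover have "P y \<in> {x. \<forall>i. i \<notin> T' \<longrightarrow> x $ i = 0}"
    by (auto simp: P_def)
  ultimately obtain c where c: "c \<in> C" "P c = P y" by (metis imageE)
  then have "c $ i = y $ i" if "i \<in> T" for i
    using that T' by (auto simp: P_def vec_eq_iff) (metis subsetD)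
  with c show ?thesis using that by blast
qed

text \<open>Translation by \<open>w - v\<close> carries \<open>V\<close> to \<open>W\<close> but may
  destroy zeros on \<open>T\<close>. Subtracting a codeword that agrees with \<open>w - v\<close> on
  \<open>T\<close> repairs this and stays in \<open>W\<close>.\<close>

lemma card_coset_vanishing_le:
  fixes C V W :: "('a::{field,finite} ^ 'n) set"
  assumes mds: "MDS_code n k d C" and "card T \<le> k" and "is_coset C V" "is_coset C W"
  shows "card {x \<in> V. \<forall>i\<in>T. x $ i = 0} \<le> card {x \<in> W. \<forall>i\<in>T. x $ i = 0}"
proof -
  obtain v w where V: "V = (\<lambda>c. c + v) ` C" and W: "W = (\<lambda>c. c + w) ` C"
    using assms by (auto simp: is_coset_def)
  have sub: "vec.subspace C"
    using mds by (auto simp: MDS_code_def linear_code_def)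
  obtain c where c: "c \<in> C" "\<And>i. i \<in> T \<Longrightarrow> c $ i = (w - v) $ i"
    using MDS_code_interpolation[OF mds \<open>card T \<le> k\<close>, of "w - v"] by blast
  have "x - c + (w - v) \<in> {x \<in> W. \<forall>i\<in>T. x $ i = 0}"
    if x: "x \<in> {x \<in> V. \<forall>i\<in>T. x $ i = 0}" for x
  proof -
    obtain b where b: "b \<in> C" "x = b + v" using x V by auto
    have "b - c \<in> C" using b c sub by (auto intro: vec.subspace_diff)
    moreover have "x - c + (w - v) = b - c + w" using b by simp
    ultimately have "x - c + (w - v) \<in> W" unfolding W by (metis imageI)
    then show ?thesis using x c by auto
  qed
  then show ?thesis
    by (intro card_inj_on_le[of "\<lambda>x. x - c + (w - v)"]) (auto simp: inj_on_def)
qed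

lemma card_coset_vanishing_eq:
  fixes C V W :: "('a::{field,finite} ^ 'n) set"
  assumes "MDS_code n k d C" and "card T \<le> k" and "is_coset C V" "is_coset C W"
  shows "card {x \<in> V. \<forall>i\<in>T. x $ i = 0} = card {x \<in> W. \<forall>i\<in>T. x $ i = 0}"
  using assms by (intro antisym card_coset_vanishing_le)

text \<open>Double counting of pairs of a vector and a \<open>t\<close>-set of its zeros; the index
  \<open>u\<close> is the exact number of zeros.\<close>

lemma sum_card_vanishing:
  fixes V :: "('a::{zero,finite} ^ 'n) set"
  shows "(\<Sum>T\<in>{T. card T = t}. card {x \<in> V. \<forall>i\<in>T. x $ i = 0})
    = (\<Sum>u\<le>CARD('n). B (CARD('n) - u) V * (u choose t))"
proof -
  let ?n = "CARD('n)"
  have wt: "hamming_weight x \<le> ?n" for x :: "'a ^ 'n"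
    unfolding hamming_weight_def by (rule card_mono) auto
  have zeros: "card {i. x $ i = 0} = ?n - hamming_weight x" for x :: "'a ^ 'n"
  proof -
    have "{i. x $ i = 0} = - {i. x $ i \<noteq> 0}" by auto
    then show ?thesis by (simp add: hamming_weight_def Compl_eq_Diff_UNIV card_Diff_subset)
  qed
  have "(\<Sum>T\<in>{T. card T = t}. card {x \<in> V. \<forall>i\<in>T. x $ i = 0})
      = (\<Sum>x\<in>V. card {T \<in> {T. card T = t}. \<forall>i\<in>T. x $ i = 0})"
    by (rule sum_multicount_gen) auto
  also have "\<dots> = (\<Sum>x\<in>V. (?n - hamming_weight x) choose t)"
  proof (rule sum.cong)
    fix x assume "x \<in> V"
    have "{T \<in> {T. card T = t}. \<forall>i\<in>T. x $ i = 0} = {T. T \<subseteq> {i. x $ i = 0} \<and> card T = t}"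
      by auto
    then show "card {T \<in> {T. card T = t}. \<forall>i\<in>T. x $ i = 0} = (?n - hamming_weight x) choose t"
      by (simp add: n_subsets zeros)
  qed simp
  also have "\<dots> = (\<Sum>u\<le>?n. \<Sum>x\<in>{x \<in> V. ?n - hamming_weight x = u}. (?n - hamming_weight x) choose t)"
    by (rule sum.group[symmetric]) auto
  also have "\<dots> = (\<Sum>u\<le>?n. B (?n - u) V * (u choose t))"
  proof (rule sum.cong)
    fix u assume "u \<in> {..?n}"
    then have "?n - hamming_weight x = u \<longleftrightarrow> hamming_weight x = ?n - u" for x :: "'a ^ 'n"
      using wt[of x] by (simp only: atMost_iff) arith
    then have "{x \<in> V. ?n - hamming_weight x = u} = {x \<in> V. hamming_weight x = ?n - u}"
      by simp
    then show "(\<Sum>x\<in>{x \<in> V. ?n - hamming_weight x = u}. (?n - hamming_weight x) choose t)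
        = B (?n - u) V * (u choose t)"
      using \<open>u \<in> {..?n}\<close> by (simp add: B_def)
  qed simp
  finally show ?thesis .
qed

lemma B_eq_0_below_coset_weight:
  assumes "w < coset_weight V"
  shows "B w V = 0"
proof -
  have "coset_weight V \<le> hamming_weight x" if "x \<in> V" for x
    unfolding coset_weight_def using that by (intro cInf_lower) auto
  then have "{x \<in> V. hamming_weight x = w} = {}" using assms by force
  then show ?thesis by (simp only: B_def card.empty)
qed

theorem theorem4p6:
  fixes C Va Vb :: "('a::{field,finite} ^ 'n) set" and n k d :: nat
  assumes "MDS_code n k d C"
    and "d \<ge> 4"
    and "is_coset C Va" and "coset_weight Va = d - 2"
    and "is_coset C Vb" and "coset_weight Vb = d - 2"
    and "weight_distribution Va \<noteq> weight_distribution Vb"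
  shows "\<forall>w\<in>{d - 1..n}.
    (- 1) ^ (n + d) * int (B w Va) - int (B (n + d - 2 - w) Va) =
    (- 1) ^ (n + d) * int (B w Vb) - int (B (n + d - 2 - w) Vb)"
proof
  fix w assume w: "w \<in> {d - 1..n}"
  have n: "n = CARD('n)" and d: "d = n - k + 1"
    using assms(1) by (auto simp: MDS_code_def linear_code_def)
  have kn: "k + 3 \<le> n" using d \<open>d \<ge> 4\<close> by simp
  define e where "e u = int (B (n - u) Va) - int (B (n - u) Vb)" for u
  \<comment> \<open>More than \<open>k + 1\<close> zeros means weight below
    \<open>n - k - 1 = d - 2\<close>, the weight of both cosets.\<close>
  have e0: "e u = 0" if "u \<le> n" "k + 1 < u" for u
    using that assms(4,6) d kn by (simp add: e_def B_eq_0_below_coset_weight)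
  have "(\<Sum>u\<le>k + 1. e u * int (u choose t)) = 0" if "t < k + 1" for t
  proof -
    have "(\<Sum>u\<le>n. B (n - u) Va * (u choose t)) = (\<Sum>u\<le>n. B (n - u) Vb * (u choose t))"
      unfolding n sum_card_vanishing[symmetric]
      using that by (intro sum.cong refl card_coset_vanishing_eq[OF assms(1) _ assms(3,5)]) auto
    then have "(\<Sum>u\<le>n. int (B (n - u) Va) * int (u choose t))
        = (\<Sum>u\<le>n. int (B (n - u) Vb) * int (u choose t))"
      by (simp flip: of_nat_mult of_nat_sum)
    then have "(\<Sum>u\<le>n. e u * int (u choose t)) = 0"
      by (simp add: e_def left_diff_distrib sum_subtractf)
    moreover have "(\<Sum>u\<le>k + 1. e u * int (u choose t)) = (\<Sum>u\<le>n. e u * int (u choose t))"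
      using kn e0 by (intro sum.mono_neutral_left) auto
    ultimately show ?thesis by simp
  qed
  \<comment> \<open>Weight \<open>w\<close> corresponds to \<open>n - w\<close> zeros, at most
    \<open>k\<close> since \<open>w \<ge> d - 1\<close>. Reflection in degree \<open>k + 1\<close>
    gives weight \<open>n + d - 2 - w\<close>.\<close>
  then have "e (k + 1 - (n - w)) = (- 1) ^ (k + 1) * e (n - w)"
    using w d kn by (intro binomial_moments_symmetry) auto
  moreover have "n - (k + 1 - (n - w)) = n + d - 2 - w" "n - (n - w) = w"
    using w d kn by auto
  \<comment> \<open>Here \<open>n + d = 2 * n - k + 1\<close>.\<close>
  moreover have "even (n + d) \<longleftrightarrow> even (k + 1)"
    using d kn by (auto simp: even_diff_nat)
  then have "(- 1) ^ (n + d) = ((- 1) ^ (k + 1) :: int)"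
    by (simp only: minus_one_power_iff)
  ultimately show "(- 1) ^ (n + d) * int (B w Va) - int (B (n + d - 2 - w) Va) =
    (- 1) ^ (n + d) * int (B w Vb) - int (B (n + d - 2 - w) Vb)"
    by (simp only: e_def right_diff_distrib)
qed

end
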